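(* Let $a \in \mathbb{R}$. Then for every $x \in (-\infty, 1]$ $$\operatorname{sign}(a)\, e^{ax} \leq \operatorname{sign}(a)\left(ax(1-x) + x^2(e^a - 1) + 1\right),$$ and for every $x \in (1, +\infty)$ $$\operatorname{sign}(a)\, e^{ax} \geq \operatorname{sign}(a)\left(ax(1-x) + x^2(e^a - 1) + 1\right).$$
   Context: $\operatorname{sign}(a) = -1$ if $a<0$, $\operatorname{sign}(a)=0$ if $a = 0$, and $\operatorname{sign}(a) = 1$ if $a>0$. *)

theory Defs imports Complex_Main begin

end

theory Submission imports Defs begin

text \<open>
  The quadratic \<open>p(x) = a x (1 - x) + x\<^sup>2 (e\<^sup>a - 1) + 1\<close> is the Hermite interpolant of
  \<open>e\<^bsup>ax\<^esup>\<close> with a double node at \<open>0\<close> and a simple node at \<open>1\<close>. Writing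
  \<open>e\<^sup>t = 1 + t + t\<^sup>2 h(t)\<close> gives
  \<open>e\<^bsup>ax\<^esup> - p(x) = a\<^sup>2 x\<^sup>2 (h(ax) - h(a))\<close>. The Taylor remainder factor
  \<open>h(t) = \<integral> (1 - s) e\<^bsup>ts\<^esup> ds\<close>, over \<open>0 \<le> s \<le> 1\<close>, is increasing in \<open>t\<close>, so the
  error is nonnegative where \<open>ax \<ge> a\<close> and nonpositive where \<open>ax \<le> a\<close>; the sign of \<open>a\<close>
  decides which of these corresponds to \<open>x \<le> 1\<close>. Lemma \<open>exp_remainder_mono\<close> is this
  monotonicity with denominators cleared.
\<close>

text \<open>
  Clearing denominators covers \<open>u = 0\<close> and \<open>v = 0\<close> without a separate case. The
  function \<open>G\<close> in the proof is an antiderivative of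
  \<open>u\<^sup>2 v\<^sup>2 (1 - s) (e\<^bsup>vs\<^esup> - e\<^bsup>us\<^esup>)\<close>, the difference of the integrands of
  \<open>h(v)\<close> and \<open>h(u)\<close> scaled by \<open>u\<^sup>2 v\<^sup>2\<close>; comparing \<open>G 0\<close> with \<open>G 1\<close> replaces
  integration.
\<close>
lemma exp_remainder_mono:
  fixes u v :: real
  assumes "u \<le> v"
  shows "v\<^sup>2 * (exp u - 1 - u) \<le> u\<^sup>2 * (exp v - 1 - v)"
proof -
  define G where "G s = u\<^sup>2 * (exp (v * s) * (1 + v * (1 - s)))
                      - v\<^sup>2 * (exp (u * s) * (1 + u * (1 - s)))" for s :: real
  have deriv: "(G has_real_derivative u\<^sup>2 * v\<^sup>2 * (1 - s) * (exp (v * s) - exp (u * s))) (at s)" for s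
    unfolding G_def
    by (auto intro!: derivative_eq_intros simp: algebra_simps power2_eq_square)
  have "G 0 \<le> G 1"
  proof (rule DERIV_nonneg_imp_nondecreasing[of 0 1 G])
    fix s :: real
    assume s: "0 \<le> s" "s \<le> 1"
    then have "u * s \<le> v * s"
      using assms by (intro mult_right_mono)
    then have "0 \<le> u\<^sup>2 * v\<^sup>2 * (1 - s) * (exp (v * s) - exp (u * s))"
      using s by simp
    with deriv show "\<exists>y. (G has_real_derivative y) (at s) \<and> 0 \<le> y"
      by blast
  qed simp
  then show ?thesis
    by (simp add: G_def algebra_simps)
qed

lemma exp_hermite_error:
  fixes a x :: real
  shows "a\<^sup>2 * (exp (a * x) - (a * x * (1 - x) + x^2 * (exp a - 1) + 1))
       = a\<^sup>2 * (exp (a * x) - 1 - a * x) - (a * x)\<^sup>2 * (exp a - 1 - a)"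
  by (simp add: algebra_simps power2_eq_square)

lemma exp_ge_hermite:
  fixes a x :: real
  assumes "a \<noteq> 0" "a \<le> a * x"
  shows "exp (a * x) \<ge> a * x * (1 - x) + x^2 * (exp a - 1) + 1"
proof -
  have "0 \<le> a\<^sup>2 * (exp (a * x) - (a * x * (1 - x) + x^2 * (exp a - 1) + 1))"
    unfolding exp_hermite_error using exp_remainder_mono[OF assms(2)] by linarith
  with \<open>a \<noteq> 0\<close> show ?thesis
    by (simp add: zero_le_mult_iff)
qed

lemma exp_le_hermite:
  fixes a x :: real
  assumes "a \<noteq> 0" "a * x \<le> a"
  shows "exp (a * x) \<le> a * x * (1 - x) + x^2 * (exp a - 1) + 1"
proof -
  have "a\<^sup>2 * (exp (a * x) - (a * x * (1 - x) + x^2 * (exp a - 1) + 1)) \<le> 0"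
    unfolding exp_hermite_error using exp_remainder_mono[OF assms(2)] by linarith
  with \<open>a \<noteq> 0\<close> show ?thesis
    by (simp add: mult_le_0_iff)
qed

theorem mainTheorem3:
  fixes a :: real
  shows "(\<forall>x::real. x \<in> {..1} \<longrightarrow>
            sgn a * exp (a * x) \<le> sgn a * (a * x * (1 - x) + x^2 * (exp a - 1) + 1)) \<and>
         (\<forall>x::real. x \<in> {1<..} \<longrightarrow>
            sgn a * exp (a * x) \<ge> sgn a * (a * x * (1 - x) + x^2 * (exp a - 1) + 1))"
proof (cases a "0 :: real" rule: linorder_cases)
  case less
  then have "x \<le> 1 \<Longrightarrow> a \<le> a * x" "1 < x \<Longrightarrow> a * x \<le> a" for x
    using mult_left_mono_neg[of x 1 a] mult_left_mono_neg[of 1 x a] by auto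
  with less show ?thesis
    using exp_ge_hermite[of a] exp_le_hermite[of a] by (simp only: sgn_neg mult_minus1 neg_le_iff_le) auto
next
  case equal
  then show ?thesis by simp
next
  case greater
  then have "x \<le> 1 \<Longrightarrow> a * x \<le> a" "1 < x \<Longrightarrow> a \<le> a * x" for x
    using mult_left_mono[of x 1 a] mult_left_mono[of 1 x a] by auto
  with greater show ?thesis
    using exp_ge_hermite[of a] exp_le_hermite[of a] by (simp only: sgn_pos) auto
qed

end
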